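(* Let $(X,A,m,\alpha,r)$ be a reversible micro-macro system such that $r$ preserves entropy, let $c\in A$ be a non-equilibrium macrostate, let $n\ge1$, and let $q\in\mathrm{Prob}(A)$ be given by $q_a=\frac{|a|}{|X^{\le|c|}|}$ if $|a|\le|c|$ and $q_a=0$ if $|a|>|c|$. Then: (a) $\mathrm{w}_n^q(x)\ge\mathrm{w}_n^q(-x)$ for all $x\ge0$; (b) $\sigma_n^q\ge0$, and $\sigma_n^q=0$ if and only if $X^{\le|c|}$ is $\alpha^n$-invariant.
   Context: A micro-macro system $(X,A,m,\alpha)$ consists of finite sets $X$, $A$, a bijection $\alpha:X\to X$ and a surjection $m:X\to A$; identify $a\in A$ with $m^{-1}(a)$, $|a|=|m^{-1}(a)|$, $|i|=|m(i)|$, $S(a)=\ln|a|$, $S(i)=\ln|m(i)|$. It is reversible with reversion $r:X\to X$ if $r^2=\mathrm{id}$ and $\alpha^{-1}=r\alpha r$; $r$ preserves entropy if $S(ri)=S(i)$ for all $i$. A non-equilibrium macrostate is one not of maximal entropy. $X^{\le|c|}=\{i\in X:|i|\le|c|\}$. $(cq)_i=q_{m(i)}/|m(i)|$, $\sigma_n(i)=\frac1n(S(\alpha^ni)-S(i))$, $\sigma_n^q=\sum_i(cq)_i\sigma_n(i)$, and $\mathrm{w}_n^q(x)=\sum_{i:\sigma_n(i)=x}(cq)_i$. *)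

theory Defs
  imports Complex_Main
begin

locale micro_macro_system =
  fixes X :: "'x set" and A :: "'a set" and m :: "'x \<Rightarrow> 'a" and \<alpha> :: "'x \<Rightarrow> 'x"
  assumes finite_X: "finite X"
    and finite_A: "finite A"
    and bij_\<alpha>: "bij_betw \<alpha> X X"
    and surj_m: "m ` X = A"

locale reversible_micro_macro_system = micro_macro_system X A m \<alpha>
  for X :: "'x set" and A :: "'a set" and m :: "'x \<Rightarrow> 'a" and \<alpha> :: "'x \<Rightarrow> 'x" +
  fixes r :: "'x \<Rightarrow> 'x"
  assumes r_closed: "r ` X \<subseteq> X"
    and r_involution: "\<And>i. i \<in> X \<Longrightarrow> r (r i) = i"
    and reversion: "\<And>i. i \<in> X \<Longrightarrow> inv_into X \<alpha> i = r (\<alpha> (r i))"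

text \<open>The cardinality \<open>|a|\<close> of a macrostate, viewed as the block \<open>m\<^sup>-\<^sup>1(a)\<close> of the partition of \<open>X\<close>.\<close>

definition macro_card :: "'x set \<Rightarrow> ('x \<Rightarrow> 'a) \<Rightarrow> 'a \<Rightarrow> nat" where
  "macro_card X m a = card {i \<in> X. m i = a}"

definition macro_entropy :: "'x set \<Rightarrow> ('x \<Rightarrow> 'a) \<Rightarrow> 'a \<Rightarrow> real" where
  "macro_entropy X m a = ln (real (macro_card X m a))"

definition micro_entropy :: "'x set \<Rightarrow> ('x \<Rightarrow> 'a) \<Rightarrow> 'x \<Rightarrow> real" where
  "micro_entropy X m i = macro_entropy X m (m i)"

definition preserves_entropy :: "'x set \<Rightarrow> ('x \<Rightarrow> 'a) \<Rightarrow> ('x \<Rightarrow> 'x) \<Rightarrow> bool" where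
  "preserves_entropy X m r \<longleftrightarrow> (\<forall>i\<in>X. micro_entropy X m (r i) = micro_entropy X m i)"

definition equilibrium :: "'x set \<Rightarrow> 'a set \<Rightarrow> ('x \<Rightarrow> 'a) \<Rightarrow> 'a \<Rightarrow> bool" where
  "equilibrium X A m a \<longleftrightarrow> a \<in> A \<and> (\<forall>b\<in>A. macro_entropy X m b \<le> macro_entropy X m a)"

definition micro_le :: "'x set \<Rightarrow> ('x \<Rightarrow> 'a) \<Rightarrow> 'a \<Rightarrow> 'x set" where
  "micro_le X m c = {i \<in> X. macro_card X m (m i) \<le> macro_card X m c}"

text \<open>Only the values on the finite set \<open>A\<close> matter.\<close>

definition Prob :: "'a set \<Rightarrow> ('a \<Rightarrow> real) set" where
  "Prob A = {q. (\<forall>a\<in>A. 0 \<le> q a) \<and> (\<Sum>a\<in>A. q a) = 1}"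

text \<open>The distribution \<open>cq\<close> on microstates, uniform on each macrostate.\<close>

definition micro_prob :: "'x set \<Rightarrow> ('x \<Rightarrow> 'a) \<Rightarrow> ('a \<Rightarrow> real) \<Rightarrow> 'x \<Rightarrow> real" where
  "micro_prob X m q i = q (m i) / real (macro_card X m (m i))"

definition entropy_rate ::
    "'x set \<Rightarrow> ('x \<Rightarrow> 'a) \<Rightarrow> ('x \<Rightarrow> 'x) \<Rightarrow> nat \<Rightarrow> 'x \<Rightarrow> real" where
  "entropy_rate X m \<alpha> n i =
     1 / real n * (micro_entropy X m ((\<alpha> ^^ n) i) - micro_entropy X m i)"

definition mean_entropy_rate ::
    "'x set \<Rightarrow> ('x \<Rightarrow> 'a) \<Rightarrow> ('x \<Rightarrow> 'x) \<Rightarrow> nat \<Rightarrow> ('a \<Rightarrow> real) \<Rightarrow> real" where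
  "mean_entropy_rate X m \<alpha> n q = (\<Sum>i\<in>X. micro_prob X m q i * entropy_rate X m \<alpha> n i)"

definition entropy_rate_weight ::
    "'x set \<Rightarrow> ('x \<Rightarrow> 'a) \<Rightarrow> ('x \<Rightarrow> 'x) \<Rightarrow> nat \<Rightarrow> ('a \<Rightarrow> real) \<Rightarrow> real \<Rightarrow> real" where
  "entropy_rate_weight X m \<alpha> n q x =
     (\<Sum>i | i \<in> X \<and> entropy_rate X m \<alpha> n i = x. micro_prob X m q i)"

definition invariant_under :: "('x \<Rightarrow> 'x) \<Rightarrow> 'x set \<Rightarrow> bool" where
  "invariant_under f Y \<longleftrightarrow> f ` Y \<subseteq> Y"

text \<open>The explicit \<open>q\<close> below is always a probability, so requiring both conditions on \<open>q\<close> is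
  no restriction.\<close>

lemma (in micro_macro_system) truncated_uniform_in_Prob:
  assumes c: "c \<in> A"
    and q: "\<forall>a\<in>A. q a =
      (if macro_card X m a \<le> macro_card X m c
       then real (macro_card X m a) / real (card (micro_le X m c)) else 0)"
  shows "q \<in> Prob A"
proof -
  let ?B = "{a\<in>A. macro_card X m a \<le> macro_card X m c}"
  obtain i where "i \<in> X" "m i = c" using c surj_m by auto
  then have "micro_le X m c \<noteq> {}" by (auto simp: micro_le_def)
  moreover have fin: "finite (micro_le X m c)" using finite_X by (simp add: micro_le_def)
  ultimately have pos: "card (micro_le X m c) > 0" by (simp add: card_gt_0_iff)
  have eq: "micro_le X m c = (\<Union>a\<in>?B. {i\<in>X. m i = a})"
    using surj_m by (auto simp: micro_le_def)
  have "card (micro_le X m c) = (\<Sum>a\<in>?B. macro_card X m a)"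
    unfolding eq macro_card_def
    by (rule card_UN_disjoint) (use finite_X finite_A in auto)
  then have card_eq: "real (card (micro_le X m c)) = (\<Sum>a\<in>?B. real (macro_card X m a))"
    by simp
  have "(\<Sum>a\<in>A. q a) = (\<Sum>a\<in>?B. real (macro_card X m a) / real (card (micro_le X m c)))"
    using q finite_A by (subst sum.inter_filter) (auto intro!: sum.cong)
  also have "\<dots> = (\<Sum>a\<in>?B. real (macro_card X m a)) / real (card (micro_le X m c))"
    by (simp add: sum_divide_distrib)
  also have "\<dots> = 1" using pos card_eq by simp
  finally have "(\<Sum>a\<in>A. q a) = 1" .
  with q show ?thesis by (simp add: Prob_def)
qed

end

theory Submission
  imports Defs
begin

text \<open>
  Put \<open>T = r \<circ> \<alpha>\<^sup>n\<close> and \<open>Y = X\<^sup>\<le>\<^sup>|\<^sup>c\<^sup>|\<close>. Reversibility makes \<open>T\<close> an involution of \<open>X\<close> that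
  exchanges the entropies of \<open>i\<close> and \<open>\<alpha>\<^sup>n i\<close>, hence changes the sign of \<open>\<sigma>\<^sub>n\<close>; and \<open>cq\<close> is
  uniform on \<open>Y\<close>. If \<open>i \<in> Y\<close> and \<open>\<sigma>\<^sub>n(i) \<le> 0\<close> then \<open>T i \<in> Y\<close>, which gives (a). The points of
  \<open>Y\<close> with \<open>\<alpha>\<^sup>n i \<in> Y\<close> are permuted by \<open>T\<close>, so their contributions to the mean cancel,
  while each point of \<open>Y\<close> leaving \<open>Y\<close> contributes a strictly positive amount; this gives (b).
\<close>

context micro_macro_system
begin

lemma funpow_closed: "i \<in> X \<Longrightarrow> (\<alpha> ^^ n) i \<in> X"
  using bij_betw_apply[OF bij_betw_funpow[OF bij_\<alpha>]] .

lemma macro_card_pos: "i \<in> X \<Longrightarrow> macro_card X m (m i) > 0"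
  using finite_X by (auto simp: macro_card_def card_gt_0_iff)

text \<open>The reversion is known to preserve entropies, so membership in \<open>micro_le\<close>
  is recast in terms of them. The logarithm is strictly monotone only on positive arguments;
  \<open>c\<close> has positive cardinality because \<open>m\<close> is onto
  \<open>A\<close>.\<close>

lemma micro_le_eq_entropy_le:
  assumes "c \<in> A"
  shows "micro_le X m c = {i \<in> X. micro_entropy X m i \<le> macro_entropy X m c}"
proof -
  obtain j where "j \<in> X" "m j = c" using assms surj_m by auto
  then have "macro_card X m c > 0" using macro_card_pos by auto
  then show ?thesis
    by (auto simp: micro_le_def micro_entropy_def macro_entropy_def macro_card_pos)
qed

text \<open>The factor |a| in \<open>q a\<close> cancels against the division by the block size in
  \<open>micro_prob\<close>.\<close>

lemma micro_prob_truncated_uniform: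
  assumes "\<forall>a\<in>A. q a =
      (if macro_card X m a \<le> macro_card X m c
       then real (macro_card X m a) / real (card (micro_le X m c)) else 0)"
    and "i \<in> X"
  shows "micro_prob X m q i = (if i \<in> micro_le X m c then 1 / real (card (micro_le X m c)) else 0)"
proof -
  have "m i \<in> A" using assms(2) surj_m by auto
  then show ?thesis
    using assms macro_card_pos[OF assms(2)] by (auto simp: micro_prob_def micro_le_def)
qed

end

context reversible_micro_macro_system
begin

text \<open>By induction from the inside out: the innermost \<open>\<alpha> r \<alpha>\<close>
  collapses to \<open>r\<close>, leaving the same expression with one power less on each side.
  Applying \<open>r\<close> to both sides shows that \<open>r\<close> after
  \<open>\<alpha> ^^ n\<close> is an involution.\<close>

lemma reversion_funpow:
  assumes "i \<in> X"
  shows "(\<alpha> ^^ n) (r ((\<alpha> ^^ n) i)) = r i"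
proof (induction n)
  case (Suc n)
  let ?j = "(\<alpha> ^^ n) i"
  have j: "?j \<in> X" "\<alpha> ?j \<in> X"
    using funpow_closed[OF assms, of n] funpow_closed[OF assms, of "Suc n"] by auto
  \<comment> \<open>The reversion identity is taken at \<open>\<alpha> ?j\<close>, whose preimage
    under \<alpha> is \<open>?j\<close>.\<close>
  have "r (\<alpha> (r (\<alpha> ?j))) = ?j"
    using reversion[OF j(2)] bij_\<alpha> j(1) by (simp add: bij_betw_def)
  moreover have "\<alpha> (r (\<alpha> ?j)) \<in> X"
    using r_closed j(2) bij_betw_apply[OF bij_\<alpha>] by blast
  ultimately have "\<alpha> (r (\<alpha> ?j)) = r ?j"
    using r_involution by metis
  then show ?case using Suc.IH by (simp add: funpow_swap1)
qed simp

definition time_reversal :: "nat \<Rightarrow> 'x \<Rightarrow> 'x" where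
  "time_reversal n i = r ((\<alpha> ^^ n) i)"

lemma time_reversal_closed: "i \<in> X \<Longrightarrow> time_reversal n i \<in> X"
  using r_closed funpow_closed by (auto simp: time_reversal_def)

lemma time_reversal_involution: "i \<in> X \<Longrightarrow> time_reversal n (time_reversal n i) = i"
  by (simp add: time_reversal_def reversion_funpow r_involution)

context
  assumes entropy: "preserves_entropy X m r"
begin

lemma micro_entropy_r: "i \<in> X \<Longrightarrow> micro_entropy X m (r i) = micro_entropy X m i"
  using entropy by (simp add: preserves_entropy_def)

lemma micro_entropy_time_reversal:
  "i \<in> X \<Longrightarrow> micro_entropy X m (time_reversal n i) = micro_entropy X m ((\<alpha> ^^ n) i)"
  by (simp add: time_reversal_def micro_entropy_r funpow_closed)

lemma micro_entropy_funpow_time_reversal: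
  "i \<in> X \<Longrightarrow> micro_entropy X m ((\<alpha> ^^ n) (time_reversal n i)) = micro_entropy X m i"
  by (simp add: time_reversal_def micro_entropy_r reversion_funpow)

lemma entropy_rate_time_reversal:
  "i \<in> X \<Longrightarrow> entropy_rate X m \<alpha> n (time_reversal n i) = - entropy_rate X m \<alpha> n i"
  by (simp add: entropy_rate_def micro_entropy_time_reversal
      micro_entropy_funpow_time_reversal diff_divide_distrib)

lemma card_entropy_rate_le:
  assumes "c \<in> A" "x \<ge> 0" "n \<ge> 1"
  shows "card {i \<in> micro_le X m c. entropy_rate X m \<alpha> n i = - x}
    \<le> card {i \<in> micro_le X m c. entropy_rate X m \<alpha> n i = x}" (is "card ?N \<le> card ?P")
proof (rule card_inj_on_le)
  show "inj_on (time_reversal n) ?N"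
    by (rule inj_on_inverseI[of _ "time_reversal n"])
      (auto simp: micro_le_def time_reversal_involution)
  show "finite ?P" using finite_X by (simp add: micro_le_def)
  show "time_reversal n ` ?N \<subseteq> ?P"
  proof (rule image_subsetI)
    fix i assume i: "i \<in> ?N"
    then have iX: "i \<in> X" by (simp add: micro_le_def)
    \<comment> \<open>Since x \<ge> 0, entropy does not rise from \<open>i\<close> to its image, so
      the reversed point still lies below the bound set by \<open>c\<close>. Clearing the
      denominator needs n \<ge> 1, as division by 0 gives 0.\<close>
    have "(micro_entropy X m ((\<alpha> ^^ n) i) - micro_entropy X m i) / real n \<le> 0"
      using i assms(2) by (simp add: entropy_rate_def)
    then have "micro_entropy X m ((\<alpha> ^^ n) i) \<le> micro_entropy X m i"
      using assms(3) by (simp add: divide_le_0_iff)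
    then show "time_reversal n i \<in> ?P"
      using i iX by (auto simp: micro_le_eq_entropy_le[OF assms(1)] time_reversal_closed
          micro_entropy_time_reversal entropy_rate_time_reversal)
  qed
qed

lemma sum_entropy_rate_eq_sum_leaving:
  assumes "c \<in> A"
  shows "(\<Sum>i\<in>micro_le X m c. entropy_rate X m \<alpha> n i) =
    (\<Sum>i | i \<in> micro_le X m c \<and> (\<alpha> ^^ n) i \<notin> micro_le X m c. entropy_rate X m \<alpha> n i)"
    (is "sum ?s ?Y = sum ?s ?L")
proof -
  let ?R = "{i \<in> ?Y. (\<alpha> ^^ n) i \<in> ?Y}"
  have fin: "finite ?Y" using finite_X by (simp add: micro_le_def)
  \<comment> \<open>Time reversal swaps the two entropies, hence the two conditions that define
    \<open>?R\<close>.\<close>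
  have closed: "time_reversal n i \<in> ?R" if "i \<in> ?R" for i
    using that by (auto simp: micro_le_eq_entropy_le[OF assms] time_reversal_closed
        funpow_closed micro_entropy_time_reversal micro_entropy_funpow_time_reversal)
  have RX: "i \<in> X" if "i \<in> ?R" for i using that by (simp add: micro_le_def)
  \<comment> \<open>Reindexing along the involution makes the sum equal to its own negative.\<close>
  have "sum ?s ?R = (\<Sum>i\<in>?R. - ?s i)"
    by (rule sum.reindex_bij_witness[of _ "time_reversal n" "time_reversal n"])
      (use closed RX time_reversal_involution entropy_rate_time_reversal in auto)
  then have "sum ?s ?R = 0" by (simp add: sum_negf)
  moreover have "sum ?s ?Y = sum ?s ?R + sum ?s ?L"
    using fin by (subst sum.union_disjoint[symmetric]) (auto intro: sum.cong)
  ultimately show ?thesis by simp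
qed

end

end

theorem theorem25:
  fixes X :: "'x set" and A :: "'a set" and m :: "'x \<Rightarrow> 'a"
    and \<alpha> r :: "'x \<Rightarrow> 'x" and c :: 'a and n :: nat and q :: "'a \<Rightarrow> real"
  assumes "reversible_micro_macro_system X A m \<alpha> r"
    and "preserves_entropy X m r"
    and "c \<in> A" and "\<not> equilibrium X A m c"
    and "n \<ge> 1"
    and "q \<in> Prob A"
    and "\<forall>a\<in>A. q a =
      (if macro_card X m a \<le> macro_card X m c
       then real (macro_card X m a) / real (card (micro_le X m c)) else 0)"
  shows "(\<forall>x\<ge>0. entropy_rate_weight X m \<alpha> n q x \<ge> entropy_rate_weight X m \<alpha> n q (- x))
    \<and> (mean_entropy_rate X m \<alpha> n q \<ge> 0
       \<and> (mean_entropy_rate X m \<alpha> n q = 0 \<longleftrightarrow> invariant_under (\<alpha> ^^ n) (micro_le X m c)))"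
proof -
  interpret reversible_micro_macro_system X A m \<alpha> r by fact
  let ?Y = "micro_le X m c" and ?s = "entropy_rate X m \<alpha> n"
  let ?N = "real (card ?Y)" and ?L = "{i \<in> micro_le X m c. (\<alpha> ^^ n) i \<notin> micro_le X m c}"
  have YX: "?Y \<subseteq> X" and fin: "finite ?Y" using finite_X by (auto simp: micro_le_def)
  obtain j where "j \<in> X" "m j = c" using assms(3) surj_m by auto
  then have "?Y \<noteq> {}" by (auto simp: micro_le_def)
  then have N: "?N > 0" using fin by (simp add: card_gt_0_iff)
  note prob = micro_prob_truncated_uniform[OF assms(7)]
  have weight: "entropy_rate_weight X m \<alpha> n q x = real (card {i \<in> ?Y. ?s i = x}) / ?N" for x
  proof -
    have "entropy_rate_weight X m \<alpha> n q x = (\<Sum>i\<in>{i \<in> ?Y. ?s i = x}. 1 / ?N)"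
      unfolding entropy_rate_weight_def
      by (rule sum.mono_neutral_cong_right) (use finite_X YX prob in auto)
    then show ?thesis by simp
  qed
  have "mean_entropy_rate X m \<alpha> n q = (\<Sum>i\<in>?Y. ?s i / ?N)"
    unfolding mean_entropy_rate_def
    by (rule sum.mono_neutral_cong_right) (use finite_X YX prob in auto)
  also have "\<dots> = sum ?s ?L / ?N"
    using sum_entropy_rate_eq_sum_leaving[OF assms(2,3)] by (simp flip: sum_divide_distrib)
  finally have mean: "mean_entropy_rate X m \<alpha> n q = sum ?s ?L / ?N" .
  have pos: "?s i > 0" if "i \<in> ?L" for i
  proof -
    \<comment> \<open>The entropy of \<open>c\<close> separates the two values: it bounds the one at
      \<open>i\<close> from above and lies strictly below the one at the image.\<close>
    have "micro_entropy X m i < micro_entropy X m ((\<alpha> ^^ n) i)"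
      using that by (auto simp: micro_le_eq_entropy_le[OF assms(3)] funpow_closed)
    then show ?thesis using assms(5) by (simp add: entropy_rate_def)
  qed
  then have "sum ?s ?L = 0 \<longleftrightarrow> ?L = {}"
    using fin by (subst sum_nonneg_eq_0_iff) (auto simp: less_imp_le less_imp_neq[symmetric])
  moreover have "?L = {} \<longleftrightarrow> invariant_under (\<alpha> ^^ n) ?Y"
    by (auto simp: invariant_under_def)
  moreover have "sum ?s ?L \<ge> 0" using pos by (intro sum_nonneg less_imp_le)
  moreover have "entropy_rate_weight X m \<alpha> n q (- x) \<le> entropy_rate_weight X m \<alpha> n q x"
    if "x \<ge> 0" for x
    using card_entropy_rate_le[OF assms(2,3) that assms(5)] N
    by (simp add: weight divide_right_mono)
  ultimately show ?thesis using N by (simp add: mean)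
qed

end
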